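(* Let $J,K\subset\mathbb{R}_+$ be open intervals, and let $E$, $F$, $G$ be normalizable semideviations on the intervals $I:=J\cdot K$, $J$, $K$, respectively, with normalizations $E^*,F^*,G^*$. Then the following assertions are equivalent: (i) for all $n\in\mathbb{N}$, $x\in J^n$, $y\in K^n$, $\lambda\in W_n(\mathbb{R})$: $\ \underline{\underline{\mathcal{D}}}_E(x\cdot y,\lambda)\le\underline{\underline{\mathcal{D}}}_F(x,\lambda)\cdot\underline{\underline{\mathcal{D}}}_G(y,\lambda)$; (ii) for all $n\in\mathbb{N}$, $x\in J^n$, $y\in K^n$, $\lambda\in W_n(\mathbb{R})$: $\ \underline{\mathcal{D}}_E(x\cdot y,\lambda)\le\underline{\mathcal{D}}_F(x,\lambda)\cdot\underline{\mathcal{D}}_G(y,\lambda)$; (iii) for all $n\in\mathbb{N}$, $x\in J^n$, $y\in K^n$, $\lambda\in W_n(\mathbb{R})$: $\ \overline{\mathcal{D}}_E(x\cdot y,\lambda)\le\overline{\mathcal{D}}_F(x,\lambda)\cdot\overline{\mathcal{D}}_G(y,\lambda)$; (iv) for all $n\in\mathbb{N}$, $x\in J^n$, $y\in K^n$, $\lambda\in W_n(\mathbb{R})$: $\ \overline{\overline{\mathcal{D}}}_E(x\cdot y,\lambda)\le\overline{\overline{\mathcal{D}}}_F(x,\lambda)\cdot\overline{\overline{\mathcal{D}}}_G(y,\lambda)$; (v) for all $n\in\mathbb{N}$, $x\in J^n$, $y\in K^n$, $\lambda\in W_n(\mathbb{R})$: $\ \underline{\underline{\mathcal{D}}}_E(x\cdot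 y,\lambda)\le\overline{\overline{\mathcal{D}}}_F(x,\lambda)\cdot\overline{\overline{\mathcal{D}}}_G(y,\lambda)$; (vi) for all $p,u\in J$ and $q,v\in K$: $\ E^*(pq,uv)\le v\,F^*(p,u)+u\,G^*(q,v)$.
   Context: $\mathbb{R}_+=(0,\infty)$, $J\cdot K=\{ab\mid a\in J,\ b\in K\}$, and for $x\in J^n$, $y\in K^n$ the product is taken componentwise: $x\cdot y=(x_1y_1,\dots,x_ny_n)$. For $n\in\mathbb{N}$, $W_n(\mathbb{R})=\{(\lambda_1,\dots,\lambda_n)\in\mathbb{R}^n\mid\lambda_i\ge0\ \forall i,\ \lambda_1+\dots+\lambda_n>0\}$. For an interval $I$, a function $E\colon I\times I\to\mathbb{R}$ is a semideviation on $I$ if for all distinct $x,y\in I$ the sign of $E(x,y)$ equals the sign of $x-y$. For $(x,\lambda)\in I^n\times W_n(\mathbb{R})$ let $e(y)=\lambda_1E(x_1,y)+\cdots+\lambda_nE(x_n,y)$, $y\in I$, and define $\underline{\underline{\mathcal{D}}}_E(x,\lambda)=\inf\{y\in I\mid e(y)\le0\}$, $\ \overline{\overline{\mathcal{D}}}_E(x,\lambda)=\sup\{y\in I\mid e(y)\ge0\}$, $\underline{\mathcal{D}}_E(x,\lambda)=\inf\{y\in I\mid e(y)<0\}$, $\ \overline{\mathcal{D}}_E(x,\lambda)=\sup\{y\in I\mid e(y)>0\}$. A semideviation $E\colon I\times I\to\mathbb{R}$ is normalizable if (a) for all $x\in I$ the function $y\mapsto E(x,y)$ is continuous on $I$; (b)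 for all $x\in I$ the function $y\mapsto E(x,y)$ is differentiable at $y=x$ (with derivative $\partial_2E(x,x)$); (c) $x\mapsto\partial_2E(x,x)$ is strictly negative and continuous on $I$. Its normalization is $E^*(x,y)=\dfrac{E(x,y)}{-\partial_2E(y,y)}$. *)

theory Defs
  imports "HOL-Analysis.Analysis" "HOL-Library.Set_Algebras"
begin

text \<open>
  A vector of length \<open>n\<close> is a function on \<open>nat\<close> of which only the values at indices \<open>i < n\<close>
  are used.  Likewise only the values of a deviation \<open>E\<close> on \<open>I \<times> I\<close> are used.
\<close>

text \<open>For \<open>n = 0\<close> the weight set is empty, so it is immaterial whether \<open>n\<close> starts at 0 or 1.\<close>

definition weights :: "nat \<Rightarrow> (nat \<Rightarrow> real) set" where
  "weights n = {l. (\<forall>i<n. 0 \<le> l i) \<and> 0 < (\<Sum>i<n. l i)}"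

definition semideviation :: "real set \<Rightarrow> (real \<Rightarrow> real \<Rightarrow> real) \<Rightarrow> bool" where
  "semideviation I E \<longleftrightarrow> (\<forall>x\<in>I. \<forall>y\<in>I. x \<noteq> y \<longrightarrow> sgn (E x y) = sgn (x - y))"

definition dev_sum ::
  "(real \<Rightarrow> real \<Rightarrow> real) \<Rightarrow> nat \<Rightarrow> (nat \<Rightarrow> real) \<Rightarrow> (nat \<Rightarrow> real) \<Rightarrow> real \<Rightarrow> real" where
  "dev_sum E n x l y = (\<Sum>i<n. l i * E (x i) y)"

text \<open>
  The four deviation means: a double bar corresponds to a non-strict inequality (\<open>le\<close>, \<open>ge\<close>),
  a single bar to a strict one (\<open>lt\<close>, \<open>gt\<close>); a lower bar to \<open>Inf\<close>, an upper bar to \<open>Sup\<close>.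
  On an open interval, for a semideviation, entries in \<open>I\<close> and weights as above, these sets are
  nonempty and bounded on the relevant side, so that the real \<open>Inf\<close> and \<open>Sup\<close> are the genuine ones.
\<close>

definition D_inf_le ::
  "real set \<Rightarrow> (real \<Rightarrow> real \<Rightarrow> real) \<Rightarrow> nat \<Rightarrow> (nat \<Rightarrow> real) \<Rightarrow> (nat \<Rightarrow> real) \<Rightarrow> real" where
  "D_inf_le I E n x l = Inf {y\<in>I. dev_sum E n x l y \<le> 0}"

definition D_sup_ge ::
  "real set \<Rightarrow> (real \<Rightarrow> real \<Rightarrow> real) \<Rightarrow> nat \<Rightarrow> (nat \<Rightarrow> real) \<Rightarrow> (nat \<Rightarrow> real) \<Rightarrow> real" where
  "D_sup_ge I E n x l = Sup {y\<in>I. dev_sum E n x l y \<ge> 0}"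

definition D_inf_lt ::
  "real set \<Rightarrow> (real \<Rightarrow> real \<Rightarrow> real) \<Rightarrow> nat \<Rightarrow> (nat \<Rightarrow> real) \<Rightarrow> (nat \<Rightarrow> real) \<Rightarrow> real" where
  "D_inf_lt I E n x l = Inf {y\<in>I. dev_sum E n x l y < 0}"

definition D_sup_gt ::
  "real set \<Rightarrow> (real \<Rightarrow> real \<Rightarrow> real) \<Rightarrow> nat \<Rightarrow> (nat \<Rightarrow> real) \<Rightarrow> (nat \<Rightarrow> real) \<Rightarrow> real" where
  "D_sup_gt I E n x l = Sup {y\<in>I. dev_sum E n x l y > 0}"

text \<open>
  The diagonal partial derivative \<open>\<partial>\<^sub>2E(x,x)\<close>, taken within \<open>I\<close> because \<open>E\<close> is meaningful
  only on \<open>I \<times> I\<close>; \<open>vector_derivative\<close> is the library's value-returning derivative within a set.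
\<close>

definition diag_deriv :: "real set \<Rightarrow> (real \<Rightarrow> real \<Rightarrow> real) \<Rightarrow> real \<Rightarrow> real" where
  "diag_deriv I E x = vector_derivative (\<lambda>y. E x y) (at x within I)"

definition normalizable :: "real set \<Rightarrow> (real \<Rightarrow> real \<Rightarrow> real) \<Rightarrow> bool" where
  "normalizable I E \<longleftrightarrow>
     (\<forall>x\<in>I. continuous_on I (\<lambda>y. E x y)) \<and>
     (\<forall>x\<in>I. (\<lambda>y. E x y) differentiable (at x within I)) \<and>
     (\<forall>x\<in>I. diag_deriv I E x < 0) \<and>
     continuous_on I (diag_deriv I E)"

definition normalization ::
  "real set \<Rightarrow> (real \<Rightarrow> real \<Rightarrow> real) \<Rightarrow> real \<Rightarrow> real \<Rightarrow> real" where
  "normalization I E x y = E x y / (- diag_deriv I E y)"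

end

theory Submission
  imports Defs
begin

text \<open>
  All four means of a semideviation lie between the \<open>D_inf_le\<close> and the \<open>D_sup_ge\<close> mean, so each of
  (i)--(iv) implies (v).  Multiplying (vi) by the weights and summing shows that the sign conditions
  on the \<open>F\<close>- and \<open>G\<close>-sums at \<open>u\<close> and \<open>v\<close> pass to the \<open>E\<close>-sum at \<open>uv\<close>, which gives (i)--(iv).
  For (v) \<open>\<Longrightarrow>\<close> (vi), give weight \<open>1\<close> to \<open>(p, q)\<close> and weight \<open>k\<close> to \<open>(u, v)\<close>: the means are
  zeros of \<open>y \<mapsto> E p y + k E u y\<close>, hence equal \<open>u + E\<^sup>* p u / k + o(1/k)\<close>, and comparing the terms of
  order \<open>1/k\<close> in (v) yields (vi).
\<close>

section \<open>Infima and suprema of real sets, and a compactness criterion for convergence\<close>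

lemma open_real_obtain_above:
  fixes S :: "real set"
  assumes "open S" "b \<in> S" "b < z"
  obtains y where "y \<in> S" "b < y" "y < z"
proof -
  obtain d where d: "d > 0" "\<And>y. dist y b < d \<Longrightarrow> y \<in> S"
    using assms by (auto simp: open_dist)
  show ?thesis
    by (rule that[of "b + min (d / 2) ((z - b) / 2)"])
       (use d(1) assms(3) in \<open>auto simp: dist_real_def min_def field_simps intro!: d(2)\<close>)
qed

lemma open_real_obtain_below:
  fixes S :: "real set"
  assumes "open S" "b \<in> S" "z < b"
  obtains y where "y \<in> S" "z < y" "y < b"
proof -
  obtain d where d: "d > 0" "\<And>y. dist y b < d \<Longrightarrow> y \<in> S"
    using assms by (auto simp: open_dist)
  show ?thesis
    by (rule that[of "b - min (d / 2) ((b - z) / 2)"])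
       (use d(1) assms(3) in \<open>auto simp: dist_real_def min_def field_simps intro!: d(2)\<close>)
qed

text \<open>Made for the sets where a deviation sum is negative or nonpositive: with
  \<open>a\<close> and \<open>b\<close> bounding the entries, nothing below \<open>a\<close> belongs
  to the set and every point of \<open>I\<close> above \<open>b\<close> does. As \<open>I\<close> is
  open, it has points above \<open>b\<close> arbitrarily close to \<open>b\<close>, which makes
  \<open>S\<close> nonempty and keeps its infimum from exceeding \<open>b\<close>.\<close>

lemma Inf_upward_set:
  fixes S I :: "real set"
  assumes "open I" "b \<in> I" "\<And>y. y \<in> S \<Longrightarrow> a \<le> y" "\<And>y. y \<in> I \<Longrightarrow> b < y \<Longrightarrow> y \<in> S"
  shows "S \<noteq> {}" "bdd_below S" "a \<le> Inf S" "Inf S \<le> b"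
proof -
  obtain y where "y \<in> I" "b < y"
    using open_real_obtain_above[OF assms(1,2), of "b + 1"] by auto
  then show ne: "S \<noteq> {}" using assms(4) by blast
  show bd: "bdd_below S" using assms(3) by (meson bdd_belowI)
  show "a \<le> Inf S" using ne assms(3) by (rule cInf_greatest)
  show "Inf S \<le> b"
  proof (rule ccontr)
    assume "\<not> Inf S \<le> b"
    then obtain y where "y \<in> I" "b < y" "y < Inf S"
      using open_real_obtain_above[OF assms(1,2), of "Inf S"] by (auto simp: not_le)
    then show False using cInf_lower[OF _ bd, of y] assms(4) by force
  qed
qed

lemma Sup_downward_set:
  fixes S I :: "real set"
  assumes "open I" "a \<in> I" "\<And>y. y \<in> S \<Longrightarrow> y \<le> b" "\<And>y. y \<in> I \<Longrightarrow> y < a \<Longrightarrow> y \<in> S"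
  shows "S \<noteq> {}" "bdd_above S" "a \<le> Sup S" "Sup S \<le> b"
proof -
  obtain y where "y \<in> I" "y < a"
    using open_real_obtain_below[OF assms(1,2), of "a - 1"] by auto
  then show ne: "S \<noteq> {}" using assms(4) by blast
  show bd: "bdd_above S" using assms(3) by (meson bdd_aboveI)
  show "Sup S \<le> b" using ne assms(3) by (rule cSup_least)
  show "a \<le> Sup S"
  proof (rule ccontr)
    assume "\<not> a \<le> Sup S"
    then obtain y where "y \<in> I" "y < a" "Sup S < y"
      using open_real_obtain_below[OF assms(1,2), of "Sup S"] by (auto simp: not_le)
    then show False using cSup_upper[OF _ bd, of y] assms(4) by force
  qed
qed

text \<open>On the part of \<open>S\<close> outside a ball about \<open>u\<close>, the function
  \<bar>f\<bar> attains a positive minimum by compactness, so values tending to 0 force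
  \<open>s k\<close> into the ball. This replaces monotonicity of a deviation in its second
  argument, which is not assumed.\<close>

lemma tendsto_unique_zero:
  fixes f :: "real \<Rightarrow> real"
  assumes "compact S" "continuous_on S f" "\<And>y. y \<in> S \<Longrightarrow> f y = 0 \<Longrightarrow> y = u"
    and "\<And>k. s k \<in> S" "(\<lambda>k. f (s k)) \<longlonglongrightarrow> 0"
  shows "s \<longlonglongrightarrow> u"
proof (rule tendstoI)
  fix e :: real assume "e > 0"
  define C where "C = S - ball u e"
  have C: "compact C" using assms(1) by (simp add: C_def compact_diff)
  show "\<forall>\<^sub>F k in sequentially. dist (s k) u < e"
  proof (cases "C = {}")
    case True
    then have "s k \<in> ball u e" for k using assms(4)[of k] by (auto simp: C_def)
    then show ?thesis by (simp add: dist_commute)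
  next
    case False
    have "continuous_on C (\<lambda>y. \<bar>f y\<bar>)"
      using continuous_on_subset[OF assms(2)] by (intro continuous_on_rabs) (auto simp: C_def)
    with C False obtain m where m: "m \<in> C" "\<And>y. y \<in> C \<Longrightarrow> \<bar>f m\<bar> \<le> \<bar>f y\<bar>"
      using continuous_attains_inf by meson
    have "f m \<noteq> 0" using m(1) assms(3) \<open>e > 0\<close> by (auto simp: C_def)
    then have "\<forall>\<^sub>F k in sequentially. dist (f (s k)) 0 < \<bar>f m\<bar>"
      using assms(5) by (intro tendstoD) auto
    then show ?thesis
    proof eventually_elim
      case (elim k)
      then have "s k \<notin> C" using m(2)[of "s k"] by auto
      then show ?case using assms(4) by (auto simp: C_def dist_commute)
    qed
  qed
qed

section \<open>Products of intervals of positive reals\<close>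

lemma open_Times_real:
  fixes J K :: "real set"
  assumes "J \<subseteq> {0<..}" "open K"
  shows "open (J * K)"
proof -
  have "J * K = (\<Union>j\<in>J. (\<lambda>k. j *\<^sub>R k) ` K)"
    by (auto simp: set_times_def)
  moreover have "open ((\<lambda>k. j *\<^sub>R k) ` K)" if "j \<in> J" for j
    using that assms by (intro open_scaling) auto
  ultimately show ?thesis by auto
qed

text \<open>\<open>J * K\<close> is the image of a connected set under the continuous multiplication
  map.\<close>

lemma is_interval_Times_real:
  fixes J K :: "real set"
  assumes "is_interval J" "is_interval K"
  shows "is_interval (J * K)"
proof -
  have "J * K = (\<lambda>z. fst z * snd z) ` (J \<times> K)"
    by (auto simp: set_times_def image_def)
  moreover have "connected (J \<times> K)"
    using assms by (intro connected_Times) (auto simp: is_interval_connected_1)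
  ultimately show ?thesis
    by (auto simp: is_interval_connected_1 intro!: connected_continuous_image continuous_intros)
qed

text \<open>Start from any factorization \<open>z = u * v\<close>. If \<open>u\<close> is below
  \<open>U\<close>, replace it by \<open>U\<close>: the cofactor \<open>z / U\<close> lies between
  \<open>V\<close> and \<open>v\<close>, hence in \<open>K\<close>. The case of a small
  \<open>v\<close> is symmetric.\<close>

lemma factor_above_ge:
  fixes J K :: "real set"
  assumes pos: "J \<subseteq> {0<..}" "K \<subseteq> {0<..}" and int: "is_interval J" "is_interval K"
    and "U \<in> J" "V \<in> K" "z \<in> J * K" "U * V < z"
  obtains u v where "u \<in> J" "v \<in> K" "U \<le> u" "V \<le> v" "z = u * v"
proof -
  obtain u v where uv: "u \<in> J" "v \<in> K" "z = u * v"
    using assms by (auto simp: set_times_def)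
  have gt: "0 < u" "0 < v" "0 < U" "0 < V"
    using uv(1,2) assms(5,6) pos by auto
  consider "U \<le> u" "V \<le> v" | "u < U" | "v < V" by linarith
  then show ?thesis
  proof cases
    case 1 then show ?thesis using that uv by blast
  next
    case 2
    have b: "V \<le> z / U" "z / U \<le> v"
      using 2 gt assms(8) uv(3) by (simp_all add: field_simps)
    then have "z / U \<in> K" using int(2) assms(6) uv(2) by (meson mem_is_interval_1_I)
    then show ?thesis using that[of U "z / U"] b(1) assms(5) gt by simp
  next
    case 3
    have b: "U \<le> z / V" "z / V \<le> u"
      using 3 gt assms(8) uv(3) by (simp_all add: field_simps)
    then have "z / V \<in> J" using int(1) assms(5) uv(1) by (meson mem_is_interval_1_I)
    then show ?thesis using that[of "z / V" V] b(1) assms(6) gt by simp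
  qed
qed

text \<open>Openness leaves room to raise \<open>U\<close> and \<open>V\<close> a little while their
  product stays below \<open>z\<close>; the non-strict version for the raised pair then gives strict
  inequalities. Strictness matters later, since only beyond a supremum is the sign of the
  corresponding sum known.\<close>

lemma factor_above:
  fixes J K :: "real set"
  assumes pos: "J \<subseteq> {0<..}" "K \<subseteq> {0<..}" and int: "is_interval J" "is_interval K"
    and op: "open J" "open K"
    and "U \<in> J" "V \<in> K" "z \<in> J * K" "U * V < z"
  obtains u v where "u \<in> J" "v \<in> K" "U < u" "V < v" "z = u * v"
proof -
  have gt: "0 < U" "0 < V" using assms(7,8) pos by auto
  then have "U < z / V" using assms(10) by (simp add: field_simps)
  then obtain U' where U': "U' \<in> J" "U < U'" "U' < z / V"
    using open_real_obtain_above[OF op(1) assms(7)] by blast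
  then have "V < z / U'" using gt by (simp add: field_simps)
  then obtain V' where V': "V' \<in> K" "V < V'" "V' < z / U'"
    using open_real_obtain_above[OF op(2) assms(8)] by blast
  have "U' * V' < z" using U' V' gt by (simp add: field_simps)
  from factor_above_ge[OF pos int U'(1) V'(1) assms(9) this] show ?thesis
    using U'(2) V'(2) that less_le_trans by metis
qed

text \<open>The two infima are taken one after the other: for fixed \<open>v\<close> divide by
  \<open>v\<close> and pass to the infimum over \<open>A\<close>, then divide by the positive number
  \<open>Inf A\<close> and pass to the infimum over \<open>B\<close>.\<close>

lemma Inf_mult_le:
  fixes A B C :: "real set"
  assumes "A \<noteq> {}" "B \<noteq> {}" "A \<subseteq> {0<..}" "B \<subseteq> {0<..}" "bdd_below C" "0 < Inf A"
    and "\<And>u v. u \<in> A \<Longrightarrow> v \<in> B \<Longrightarrow> u * v \<in> C"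
  shows "Inf C \<le> Inf A * Inf B"
proof -
  have "Inf C / v \<le> Inf A" if "v \<in> B" for v
  proof (intro cInf_greatest assms(1))
    fix u assume "u \<in> A"
    then have "Inf C \<le> u * v" using that assms(5,7) by (intro cInf_lower)
    moreover have "0 < v" using that assms(4) by auto
    ultimately show "Inf C / v \<le> u" by (simp add: field_simps)
  qed
  moreover have "0 < v" if "v \<in> B" for v using that assms(4) by auto
  ultimately have "Inf C / Inf A \<le> v" if "v \<in> B" for v
    using that assms(6) by (simp add: field_simps)
  then have "Inf C / Inf A \<le> Inf B"
    using assms(2) by (intro cInf_greatest)
  then show ?thesis using assms(6) by (simp add: field_simps)
qed

section \<open>Deviation means of a semideviation on an open interval\<close>

locale interval_semideviation =
  fixes I :: "real set" and E :: "real \<Rightarrow> real \<Rightarrow> real"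
  assumes open_I: "open I" and interval_I: "is_interval I" and semidev: "semideviation I E"
begin

lemma dev_pos: "x \<in> I \<Longrightarrow> y \<in> I \<Longrightarrow> y < x \<Longrightarrow> 0 < E x y"
  using semidev[unfolded semideviation_def, rule_format, of x y]
  by (simp add: sgn_if split: if_splits)

lemma dev_neg: "x \<in> I \<Longrightarrow> y \<in> I \<Longrightarrow> x < y \<Longrightarrow> E x y < 0"
  using semidev[unfolded semideviation_def, rule_format, of x y]
  by (simp add: sgn_if split: if_splits)

lemma atLeastAtMost_subset:
  assumes "a \<in> I" "b \<in> I" shows "{a..b} \<subseteq> I"
proof
  fix c assume "c \<in> {a..b}"
  then show "c \<in> I" using mem_is_interval_1_I[OF interval_I assms, of c] by simp
qed

text \<open>The least and the greatest entry serve; they exist because the total weight is positive,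
  which forces \<open>n\<close> to be nonzero.\<close>

lemma weighted_range:
  assumes "x \<in> {..<n} \<rightarrow> I" "l \<in> weights n"
  obtains a b where "a \<in> I" "b \<in> I" "\<forall>i<n. a \<le> x i \<and> x i \<le> b"
proof -
  have "n \<noteq> 0" using assms(2) by (cases n) (auto simp: weights_def)
  then have ne: "x ` {..<n} \<noteq> {}" by auto
  have sub: "x ` {..<n} \<subseteq> I" using assms(1) by auto
  show ?thesis
  proof (rule that)
    show "Min (x ` {..<n}) \<in> I" using Min_in[OF _ ne] sub by blast
    show "Max (x ` {..<n}) \<in> I" using Max_in[OF _ ne] sub by blast
    show "\<forall>i<n. Min (x ` {..<n}) \<le> x i \<and> x i \<le> Max (x ` {..<n})"
      by (intro allI impI conjI Min_le Max_ge) auto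
  qed
qed

text \<open>Any enclosing pair \<open>a\<close>, \<open>b\<close> from \<open>I\<close> is allowed,
  so the facts apply to a single entry with \<open>a = b\<close> as well as to two entries with
  their minimum and maximum.\<close>

context
  fixes n :: nat and x l :: "nat \<Rightarrow> real" and a b :: real
  assumes l: "l \<in> weights n" and a: "a \<in> I" and b: "b \<in> I"
    and range: "\<forall>i<n. a \<le> x i \<and> x i \<le> b"
begin

lemma entry_mem: "i < n \<Longrightarrow> x i \<in> I"
  using atLeastAtMost_subset[OF a b] range[rule_format, of i] by auto

lemma ex_pos_weight: obtains i where "i < n" "0 < l i"
proof -
  have "\<exists>i<n. 0 < l i"
  proof (rule ccontr)
    assume "\<not> ?thesis"
    then have "(\<Sum>i<n. l i) \<le> 0" by (intro sum_nonpos) (meson lessThan_iff not_less)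
    then show False using l by (auto simp: weights_def)
  qed
  then show ?thesis using that by blast
qed

text \<open>Individual weights may vanish, but the one positive weight makes the sum strictly
  positive.\<close>

lemma weighted_sum_pos:
  assumes "\<And>i. i < n \<Longrightarrow> 0 < f i" shows "0 < (\<Sum>i<n. l i * f i)"
proof -
  obtain j where j: "j < n" "0 < l j" by (rule ex_pos_weight)
  have "0 \<le> l i * f i" if "i < n" for i
    using l assms[OF that] that by (simp add: weights_def)
  moreover have "0 < l j * f j" using j assms[OF j(1)] by simp
  ultimately show ?thesis using j(1) by (intro sum_pos2[of _ j]) auto
qed

lemma dev_sum_pos:
  assumes "y \<in> I" "y < a" shows "0 < dev_sum E n x l y"
  unfolding dev_sum_def
proof (rule weighted_sum_pos)
  fix i assume "i < n"
  then show "0 < E (x i) y"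
    using dev_pos[OF entry_mem assms(1)] range[rule_format, of i] assms(2) by simp
qed

lemma dev_sum_neg:
  assumes "y \<in> I" "b < y" shows "dev_sum E n x l y < 0"
proof -
  have "0 < (\<Sum>i<n. l i * (- E (x i) y))"
  proof (rule weighted_sum_pos)
    fix i assume "i < n"
    then show "0 < - E (x i) y"
      using dev_neg[OF entry_mem assms(1)] range[rule_format, of i] assms(2) by simp
  qed
  then show ?thesis by (simp add: dev_sum_def sum_negf)
qed

lemma dev_sum_nonpos_ge: "y \<in> I \<Longrightarrow> dev_sum E n x l y \<le> 0 \<Longrightarrow> a \<le> y"
  using dev_sum_pos[of y] by force

lemma dev_sum_nonneg_le: "y \<in> I \<Longrightarrow> 0 \<le> dev_sum E n x l y \<Longrightarrow> y \<le> b"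
  using dev_sum_neg[of y] by force

text \<open>Together with its three companions this shows that the real \<open>Inf\<close> and
  \<open>Sup\<close> in the means are genuine and that all four means lie between the bounds of the
  entries.\<close>

lemma inf_le_facts:
  "{y \<in> I. dev_sum E n x l y \<le> 0} \<noteq> {}" "bdd_below {y \<in> I. dev_sum E n x l y \<le> 0}"
  "a \<le> D_inf_le I E n x l" "D_inf_le I E n x l \<le> b"
  unfolding D_inf_le_def
  using Inf_upward_set[OF open_I b, of "{y \<in> I. dev_sum E n x l y \<le> 0}" a]
    dev_sum_nonpos_ge dev_sum_neg by (auto simp: less_imp_le)

lemma inf_lt_facts:
  "{y \<in> I. dev_sum E n x l y < 0} \<noteq> {}" "bdd_below {y \<in> I. dev_sum E n x l y < 0}"
  "a \<le> D_inf_lt I E n x l" "D_inf_lt I E n x l \<le> b"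
  unfolding D_inf_lt_def
  using Inf_upward_set[OF open_I b, of "{y \<in> I. dev_sum E n x l y < 0}" a]
    dev_sum_nonpos_ge dev_sum_neg by (auto simp: less_imp_le)

lemma sup_ge_facts:
  "{y \<in> I. 0 \<le> dev_sum E n x l y} \<noteq> {}" "bdd_above {y \<in> I. 0 \<le> dev_sum E n x l y}"
  "a \<le> D_sup_ge I E n x l" "D_sup_ge I E n x l \<le> b"
  unfolding D_sup_ge_def
  using Sup_downward_set[OF open_I a, of "{y \<in> I. 0 \<le> dev_sum E n x l y}" b]
    dev_sum_nonneg_le dev_sum_pos by (auto simp: less_imp_le)

lemma sup_gt_facts:
  "{y \<in> I. 0 < dev_sum E n x l y} \<noteq> {}" "bdd_above {y \<in> I. 0 < dev_sum E n x l y}"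
  "a \<le> D_sup_gt I E n x l" "D_sup_gt I E n x l \<le> b"
  unfolding D_sup_gt_def
  using Sup_downward_set[OF open_I a, of "{y \<in> I. 0 < dev_sum E n x l y}" b]
    dev_sum_nonneg_le dev_sum_pos by (auto simp: less_imp_le)

lemma mean_mem:
  "D_inf_le I E n x l \<in> I" "D_inf_lt I E n x l \<in> I"
  "D_sup_gt I E n x l \<in> I" "D_sup_ge I E n x l \<in> I"
  using atLeastAtMost_subset[OF a b] inf_le_facts inf_lt_facts sup_ge_facts sup_gt_facts by auto

lemma D_inf_le_lower: "y \<in> I \<Longrightarrow> dev_sum E n x l y \<le> 0 \<Longrightarrow> D_inf_le I E n x l \<le> y"
  unfolding D_inf_le_def using inf_le_facts(2) by (auto intro: cInf_lower)

lemma D_inf_lt_lower: "y \<in> I \<Longrightarrow> dev_sum E n x l y < 0 \<Longrightarrow> D_inf_lt I E n x l \<le> y"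
  unfolding D_inf_lt_def using inf_lt_facts(2) by (auto intro: cInf_lower)

lemma D_sup_ge_upper: "y \<in> I \<Longrightarrow> 0 \<le> dev_sum E n x l y \<Longrightarrow> y \<le> D_sup_ge I E n x l"
  unfolding D_sup_ge_def using sup_ge_facts(2) by (auto intro: cSup_upper)

lemma D_sup_gt_upper: "y \<in> I \<Longrightarrow> 0 < dev_sum E n x l y \<Longrightarrow> y \<le> D_sup_gt I E n x l"
  unfolding D_sup_gt_def using sup_gt_facts(2) by (auto intro: cSup_upper)

text \<open>Two inequalities come from inclusion of the defining sets. For the other two, a point of
  \<open>I\<close> strictly between the means in the wrong order would violate both of two
  complementary sign conditions on the sum.\<close>

lemma mean_order:
  "D_inf_le I E n x l \<le> D_inf_lt I E n x l" "D_inf_le I E n x l \<le> D_sup_gt I E n x l"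
  "D_inf_lt I E n x l \<le> D_sup_ge I E n x l" "D_sup_gt I E n x l \<le> D_sup_ge I E n x l"
proof -
  show "D_inf_le I E n x l \<le> D_inf_lt I E n x l"
    unfolding D_inf_le_def D_inf_lt_def using inf_lt_facts(1) inf_le_facts(2)
    by (intro cInf_superset_mono) auto
  show "D_sup_gt I E n x l \<le> D_sup_ge I E n x l"
    unfolding D_sup_gt_def D_sup_ge_def using sup_gt_facts(1) sup_ge_facts(2)
    by (intro cSup_subset_mono) auto
  have mid: "\<exists>z\<in>I. c < z \<and> z < d" if "c \<in> I" "d \<in> I" "c < d" for c d
    using dense[OF that(3)] atLeastAtMost_subset[OF that(1,2)] by (force simp: subset_iff)
  show "D_inf_le I E n x l \<le> D_sup_gt I E n x l"
  proof (rule ccontr)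
    assume "\<not> ?thesis"
    then obtain z where "z \<in> I" "D_sup_gt I E n x l < z" "z < D_inf_le I E n x l"
      using mid[OF mean_mem(3) mean_mem(1)] by (auto simp: not_le)
    then show False using D_inf_le_lower[of z] D_sup_gt_upper[of z] by linarith
  qed
  show "D_inf_lt I E n x l \<le> D_sup_ge I E n x l"
  proof (rule ccontr)
    assume "\<not> ?thesis"
    then obtain z where "z \<in> I" "D_sup_ge I E n x l < z" "z < D_inf_lt I E n x l"
      using mid[OF mean_mem(4) mean_mem(2)] by (auto simp: not_le)
    then show False using D_inf_lt_lower[of z] D_sup_ge_upper[of z] by linarith
  qed
qed

text \<open>By continuity a strict sign persists near a mean. A negative value at the lower mean
  would put smaller points into the set, a positive one would keep the set away from its own
  infimum; the upper mean is dual.\<close>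

lemma dev_sum_root:
  assumes "\<And>z. z \<in> I \<Longrightarrow> continuous_on I (\<lambda>y. E z y)"
  shows "dev_sum E n x l (D_inf_le I E n x l) = 0" "dev_sum E n x l (D_sup_ge I E n x l) = 0"
proof -
  have "continuous_on I (dev_sum E n x l)"
    unfolding dev_sum_def using assms entry_mem by (intro continuous_intros) auto
  from continuous_open_preimage[OF this open_I, of "{0<..}"]
    continuous_open_preimage[OF this open_I, of "{..<0}"]
  have op: "open {y \<in> I. dev_sum E n x l y > 0}" "open {y \<in> I. dev_sum E n x l y < 0}"
    by (simp_all add: vimage_def Int_def)
  let ?m = "D_inf_le I E n x l" and ?M = "D_sup_ge I E n x l"
  have "\<not> dev_sum E n x l ?m < 0"
  proof
    assume "dev_sum E n x l ?m < 0"
    then obtain y where "y \<in> I" "dev_sum E n x l y < 0" "y < ?m"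
      using open_real_obtain_below[OF op(2), of ?m "?m - 1"] mean_mem by auto
    then show False using D_inf_le_lower[of y] by auto
  qed
  moreover have "\<not> dev_sum E n x l ?m > 0"
  proof
    assume "dev_sum E n x l ?m > 0"
    then obtain d where d: "d > 0" "\<And>y. dist y ?m < d \<Longrightarrow> dev_sum E n x l y > 0"
      using op(1) mean_mem unfolding open_dist by blast
    \<comment> \<open>This point is at least \<open>?m\<close> as a member of the set, so it falls
      within distance \<open>d\<close> of \<open>?m\<close>, where the sum is positive.\<close>
    obtain s where "s \<in> I" "dev_sum E n x l s \<le> 0" "s < ?m + d"
      using cInf_lessD[OF inf_le_facts(1), of "?m + d"] d(1) by (auto simp: D_inf_le_def)
    moreover from this have "?m \<le> s" by (intro D_inf_le_lower)
    ultimately show False using d(2)[of s] by (auto simp: dist_real_def)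
  qed
  ultimately show "dev_sum E n x l ?m = 0" by simp
  have "\<not> dev_sum E n x l ?M > 0"
  proof
    assume "dev_sum E n x l ?M > 0"
    then obtain y where "y \<in> I" "dev_sum E n x l y > 0" "?M < y"
      using open_real_obtain_above[OF op(1), of ?M "?M + 1"] mean_mem by auto
    then show False using D_sup_ge_upper[of y] by auto
  qed
  moreover have "\<not> dev_sum E n x l ?M < 0"
  proof
    assume "dev_sum E n x l ?M < 0"
    then obtain d where d: "d > 0" "\<And>y. dist y ?M < d \<Longrightarrow> dev_sum E n x l y < 0"
      using op(2) mean_mem unfolding open_dist by blast
    obtain s where "s \<in> I" "dev_sum E n x l s \<ge> 0" "?M - d < s"
      using less_cSupD[OF sup_ge_facts(1), of "?M - d"] d(1) by (auto simp: D_sup_ge_def)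
    moreover from this have "s \<le> ?M" by (intro D_sup_ge_upper)
    ultimately show False using d(2)[of s] by (auto simp: dist_real_def)
  qed
  ultimately show "dev_sum E n x l ?M = 0" by simp
qed

end

end

section \<open>Asymptotics of two-point means as one weight grows\<close>

locale normalizable_semideviation = interval_semideviation +
  assumes normal: "normalizable I E"
begin

lemma cont: "x \<in> I \<Longrightarrow> continuous_on I (\<lambda>y. E x y)"
  using normal by (simp add: normalizable_def)

lemma diag_neg: "x \<in> I \<Longrightarrow> diag_deriv I E x < 0"
  using normal by (simp add: normalizable_def)

text \<open>The definition of a semideviation leaves the diagonal free. The lower mean of the single
  entry \<open>x\<close> is squeezed to \<open>x\<close>, and continuity makes it a root of the
  one-term sum.\<close>

lemma diag_zero:
  assumes "x \<in> I" shows "E x x = 0"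
proof -
  have l: "(\<lambda>i::nat. 1::real) \<in> weights 1" by (simp add: weights_def)
  have "D_inf_le I E 1 (\<lambda>_. x) (\<lambda>_. 1) = x"
    using inf_le_facts(3,4)[OF l assms assms, of "\<lambda>_. x", simplified] by auto
  then show ?thesis
    using dev_sum_root(1)[OF l assms assms, of "\<lambda>_. x", simplified] cont by (auto simp: dev_sum_def)
qed

text \<open>This is the limit of the difference quotient, simplified by the vanishing of
  \<open>E\<close> on the diagonal.\<close>

lemma slope_tendsto:
  assumes "u \<in> I"
  shows "((\<lambda>y. E u y / (y - u)) \<longlongrightarrow> diag_deriv I E u) (at u within I)"
proof -
  have "((\<lambda>y. E u y) has_real_derivative diag_deriv I E u) (at u within I)"
    using normal assms
    by (simp add: normalizable_def diag_deriv_def has_real_derivative_iff_has_vector_derivative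
        vector_derivative_works)
  then show ?thesis by (simp add: has_field_derivative_iff diag_zero[OF assms])
qed

text \<open>The root equation rewrites \<open>real (Suc k) * (s k - u)\<close> as
  \<open>- E p (s k)\<close> divided by the slope \<open>E u (s k) / (s k - u)\<close>. Once
  \<open>s\<close> is known to tend to \<open>u\<close>, the numerator tends to
  \<open>- E p u\<close> and the slope to the diagonal derivative.\<close>

lemma root_asymptotics:
  assumes p: "p \<in> I" and u: "u \<in> I" and s: "\<And>k. s k \<in> {min p u..max p u}"
    and root: "\<And>k. E p (s k) + real (Suc k) * E u (s k) = 0"
  shows "(\<lambda>k. real (Suc k) * (s k - u)) \<longlonglongrightarrow> normalization I E p u"
proof (cases "p = u")
  case True
  then have "s k = u" for k using s[of k] by simp
  then show ?thesis using True u by (simp add: normalization_def diag_zero)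
next
  case False
  let ?S = "{min p u..max p u}"
  have S: "?S \<subseteq> I" using atLeastAtMost_subset p u by (auto simp: min_def max_def)
  have sI: "s k \<in> I" for k using S s by blast
  have zero_u: "y = u" if "y \<in> I" "E u y = 0" for y
    using dev_pos[OF u that(1)] dev_neg[OF u that(1)] that(2) by force
  have zero_p: "y = p" if "y \<in> I" "E p y = 0" for y
    using dev_pos[OF p that(1)] dev_neg[OF p that(1)] that(2) by force
  \<comment> \<open>At \<open>u\<close> the second term of the root equation vanishes, leaving
    \<open>E p u = 0\<close> and hence \<open>p = u\<close>. So the slopes below have nonzero
    denominators.\<close>
  have ne: "s k \<noteq> u" for k
    using root[of k] diag_zero[OF u] zero_p[OF u] False by auto
  have "compact ((\<lambda>y. E p y) ` ?S)"
    by (rule compact_continuous_image[OF continuous_on_subset[OF cont[OF p] S]]) simp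
  then obtain B where B: "\<And>y. y \<in> ?S \<Longrightarrow> \<bar>E p y\<bar> \<le> B"
    by (fastforce dest!: compact_imp_bounded simp: bounded_iff)
  \<comment> \<open>The numerator is bounded by \<open>B\<close>, so \<open>E u (s k)\<close> tends
    to 0; since \<open>u\<close> is the only zero of \<open>E u\<close> in the segment,
    \<open>s\<close> tends to \<open>u\<close>.\<close>
  have Eu: "E u (s k) = - E p (s k) / real (Suc k)" for k
    using root[of k] by (simp add: field_simps del: of_nat_Suc)
  have "(\<lambda>k. B / real (Suc k)) \<longlonglongrightarrow> 0"
    using LIMSEQ_Suc[OF lim_const_over_n[of B]] by simp
  then have "(\<lambda>k. E u (s k)) \<longlonglongrightarrow> 0"
    by (rule Lim_null_comparison[rotated])
       (use B s in \<open>auto simp: Eu abs_div divide_right_mono simp del: of_nat_Suc\<close>)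
  then have lim: "s \<longlonglongrightarrow> u"
    by (rule tendsto_unique_zero[rotated 4])
       (use S s zero_u continuous_on_subset[OF cont[OF u] S] in auto)
  have "filterlim s (at u within I) sequentially"
    using lim ne sI by (auto simp: filterlim_at)
  from filterlim_compose[OF slope_tendsto[OF u] this]
  have slope: "(\<lambda>k. E u (s k) / (s k - u)) \<longlonglongrightarrow> diag_deriv I E u" .
  have "(\<lambda>k. E p (s k)) \<longlonglongrightarrow> E p u"
    using continuous_on_tendsto_compose[OF cont[OF p] lim u] sI by simp
  then have "(\<lambda>k. - E p (s k) / (E u (s k) / (s k - u))) \<longlonglongrightarrow> - E p u / diag_deriv I E u"
    using slope diag_neg[OF u] by (intro tendsto_divide tendsto_minus) auto
  moreover have "- E p (s k) / (E u (s k) / (s k - u)) = real (Suc k) * (s k - u)" for k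
  proof -
    have "E u (s k) \<noteq> 0" using zero_u[OF sI] ne by blast
    moreover have "- E p (s k) = real (Suc k) * E u (s k)" using root[of k] by linarith
    ultimately show ?thesis by (simp del: of_nat_Suc)
  qed
  ultimately show ?thesis by (simp add: normalization_def del: of_nat_Suc)
qed

text \<open>Both means are zeros of the two-term sum and lie between \<open>p\<close> and
  \<open>u\<close>, so the asymptotics of roots apply. The growing weight is \<open>Suc k\<close>,
  positive from \<open>k = 0\<close> on.\<close>

lemma mean_asymptotics:
  assumes "p \<in> I" "u \<in> I"
  defines "x \<equiv> \<lambda>i::nat. if i = 0 then p else u"
    and "l \<equiv> \<lambda>k i. if i = 0 then 1 else real (Suc k)"
  shows "(\<lambda>k. real (Suc k) * (D_inf_le I E 2 x (l k) - u)) \<longlonglongrightarrow> normalization I E p u"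
    and "(\<lambda>k. real (Suc k) * (D_sup_ge I E 2 x (l k) - u)) \<longlonglongrightarrow> normalization I E p u"
proof -
  have sum: "dev_sum E 2 x (l k) y = E p y + real (Suc k) * E u y" for k y
    by (simp add: dev_sum_def x_def l_def numeral_2_eq_2)
  have l: "l k \<in> weights 2" for k
    by (auto simp: weights_def l_def numeral_2_eq_2)
  have ab: "min p u \<in> I" "max p u \<in> I" using assms by (auto simp: min_def max_def)
  have range: "\<forall>i<2. min p u \<le> x i \<and> x i \<le> max p u" by (simp add: x_def)
  note facts = l ab range
  show "(\<lambda>k. real (Suc k) * (D_inf_le I E 2 x (l k) - u)) \<longlonglongrightarrow> normalization I E p u"
    using inf_le_facts(3,4)[OF facts] dev_sum_root(1)[OF facts cont]
    by (intro root_asymptotics assms) (auto simp: sum simp del: of_nat_Suc)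
  show "(\<lambda>k. real (Suc k) * (D_sup_ge I E 2 x (l k) - u)) \<longlonglongrightarrow> normalization I E p u"
    using sup_ge_facts(3,4)[OF facts] dev_sum_root(2)[OF facts cont]
    by (intro root_asymptotics assms) (auto simp: sum simp del: of_nat_Suc)
qed

end

section \<open>Equivalence of the mean inequalities with the inequality between
  normalizations\<close>

theorem corollary7p4:
  fixes J K I :: "real set" and E F G :: "real \<Rightarrow> real \<Rightarrow> real"
  assumes "J \<subseteq> {0<..}" "open J" "is_interval J"
    and "K \<subseteq> {0<..}" "open K" "is_interval K"
    and "I = J * K"
    and "semideviation I E" "normalizable I E"
    and "semideviation J F" "normalizable J F"
    and "semideviation K G" "normalizable K G"
  shows
    "let
       A_i = (\<forall>n x y l. x \<in> {..<n} \<rightarrow> J \<longrightarrow> y \<in> {..<n} \<rightarrow> K \<longrightarrow> l \<in> weights n \<longrightarrow>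
              D_inf_le I E n (\<lambda>i. x i * y i) l \<le> D_inf_le J F n x l * D_inf_le K G n y l);
       A_ii = (\<forall>n x y l. x \<in> {..<n} \<rightarrow> J \<longrightarrow> y \<in> {..<n} \<rightarrow> K \<longrightarrow> l \<in> weights n \<longrightarrow>
              D_inf_lt I E n (\<lambda>i. x i * y i) l \<le> D_inf_lt J F n x l * D_inf_lt K G n y l);
       A_iii = (\<forall>n x y l. x \<in> {..<n} \<rightarrow> J \<longrightarrow> y \<in> {..<n} \<rightarrow> K \<longrightarrow> l \<in> weights n \<longrightarrow>
              D_sup_gt I E n (\<lambda>i. x i * y i) l \<le> D_sup_gt J F n x l * D_sup_gt K G n y l);
       A_iv = (\<forall>n x y l. x \<in> {..<n} \<rightarrow> J \<longrightarrow> y \<in> {..<n} \<rightarrow> K \<longrightarrow> l \<in> weights n \<longrightarrow>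
              D_sup_ge I E n (\<lambda>i. x i * y i) l \<le> D_sup_ge J F n x l * D_sup_ge K G n y l);
       A_v = (\<forall>n x y l. x \<in> {..<n} \<rightarrow> J \<longrightarrow> y \<in> {..<n} \<rightarrow> K \<longrightarrow> l \<in> weights n \<longrightarrow>
              D_inf_le I E n (\<lambda>i. x i * y i) l \<le> D_sup_ge J F n x l * D_sup_ge K G n y l);
       A_vi = (\<forall>p\<in>J. \<forall>u\<in>J. \<forall>q\<in>K. \<forall>v\<in>K.
              normalization I E (p * q) (u * v)
                \<le> v * normalization J F p u + u * normalization K G q v)
     in (A_i \<longleftrightarrow> A_ii) \<and> (A_ii \<longleftrightarrow> A_iii) \<and> (A_iii \<longleftrightarrow> A_iv) \<and>
        (A_iv \<longleftrightarrow> A_v) \<and> (A_v \<longleftrightarrow> A_vi)"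
proof -
  interpret E: normalizable_semideviation I E
    using assms by unfold_locales (auto intro: open_Times_real is_interval_Times_real)
  interpret F: normalizable_semideviation J F
    using assms by unfold_locales auto
  interpret G: normalizable_semideviation K G
    using assms by unfold_locales auto
  have mult: "u * v \<in> I" if "u \<in> J" "v \<in> K" for u v
    using that assms(7) by auto
  have pos: "u \<in> J \<Longrightarrow> 0 < u" "v \<in> K \<Longrightarrow> 0 < v" for u v
    using assms(1,4) by auto

  define vi where "vi \<longleftrightarrow> (\<forall>p\<in>J. \<forall>u\<in>J. \<forall>q\<in>K. \<forall>v\<in>K.
            normalization I E (p * q) (u * v)
              \<le> v * normalization J F p u + u * normalization K G q v)"
  define v where "v \<longleftrightarrow> (\<forall>n x y l. x \<in> {..<n} \<rightarrow> J \<longrightarrow> y \<in> {..<n} \<rightarrow> K \<longrightarrow> l \<in> weights n \<longrightarrow>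
            D_inf_le I E n (\<lambda>i. x i * y i) l \<le> D_sup_ge J F n x l * D_sup_ge K G n y l)"

  \<comment> \<open>The disjunction treats (i)--(iv) at once for one choice of entries and weights.
    Passing to (v) can only lower the left-hand mean and raise the two factors, and positivity of
    the means makes the product monotone.\<close>
  have all_imp_v: "D_inf_le I E n (\<lambda>i. x i * y i) l \<le> D_sup_ge J F n x l * D_sup_ge K G n y l"
    if xyl: "x \<in> {..<n} \<rightarrow> J" "y \<in> {..<n} \<rightarrow> K" "l \<in> weights n"
      and "D_inf_le I E n (\<lambda>i. x i * y i) l \<le> D_inf_le J F n x l * D_inf_le K G n y l
        \<or> D_inf_lt I E n (\<lambda>i. x i * y i) l \<le> D_inf_lt J F n x l * D_inf_lt K G n y l
        \<or> D_sup_gt I E n (\<lambda>i. x i * y i) l \<le> D_sup_gt J F n x l * D_sup_gt K G n y l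
        \<or> D_sup_ge I E n (\<lambda>i. x i * y i) l \<le> D_sup_ge J F n x l * D_sup_ge K G n y l"
    for n x y l
  proof -
    obtain a b where ab: "a \<in> J" "b \<in> J" "\<forall>i<n. a \<le> x i \<and> x i \<le> b"
      using F.weighted_range[OF xyl(1,3)] by blast
    obtain c d where cd: "c \<in> K" "d \<in> K" "\<forall>i<n. c \<le> y i \<and> y i \<le> d"
      using G.weighted_range[OF xyl(2,3)] by blast
    have "(\<lambda>i. x i * y i) \<in> {..<n} \<rightarrow> I" using xyl mult by blast
    then obtain e f where ef: "e \<in> I" "f \<in> I" "\<forall>i<n. e \<le> x i * y i \<and> x i * y i \<le> f"
      using E.weighted_range[of "\<lambda>i. x i * y i" n l] xyl by blast
    note m = E.mean_order[OF xyl(3) ef] F.mean_order[OF xyl(3) ab] G.mean_order[OF xyl(3) cd]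
    note p = F.mean_mem[OF xyl(3) ab, THEN pos(1)] G.mean_mem[OF xyl(3) cd, THEN pos(2)]
    have "r * s \<le> D_sup_ge J F n x l * D_sup_ge K G n y l"
      if "r \<le> D_sup_ge J F n x l" "s \<le> D_sup_ge K G n y l" "0 < s" for r s
      using that p by (intro mult_mono) auto
    then show ?thesis
      using that(4) m p by (smt (verit))
  qed

  have v_imp_vi: vi if v
    unfolding vi_def
  proof (intro ballI)
    \<comment> \<open>The second point of \<open>K\<close> is called \<open>w\<close> because
      \<open>v\<close> now names assertion (v).\<close>
    fix p u q w assume puqw: "p \<in> J" "u \<in> J" "q \<in> K" "w \<in> K"
    define x y where "x = (\<lambda>i::nat. if i = 0 then p else u)"
      and "y = (\<lambda>i::nat. if i = 0 then q else w)"
    define l where "l = (\<lambda>k (i::nat). if i = 0 then 1 else real (Suc k))"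
    have xy: "(\<lambda>i. x i * y i) = (\<lambda>i. if i = 0 then p * q else u * w)"
      by (auto simp: x_def y_def)
    define DE where "DE = (\<lambda>k. D_inf_le I E 2 (\<lambda>i. x i * y i) (l k))"
    define DF where "DF = (\<lambda>k. D_sup_ge J F 2 x (l k))"
    define DG where "DG = (\<lambda>k. D_sup_ge K G 2 y (l k))"
    have E: "(\<lambda>k. real (Suc k) * (DE k - u * w)) \<longlonglongrightarrow> normalization I E (p * q) (u * w)"
      unfolding DE_def xy l_def by (intro E.mean_asymptotics mult puqw)
    have F: "(\<lambda>k. real (Suc k) * (DF k - u)) \<longlonglongrightarrow> normalization J F p u"
      unfolding DF_def x_def l_def by (intro F.mean_asymptotics puqw)
    have G: "(\<lambda>k. real (Suc k) * (DG k - w)) \<longlonglongrightarrow> normalization K G q w"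
      unfolding DG_def y_def l_def by (intro G.mean_asymptotics puqw)
    \<comment> \<open>Since \<open>real (Suc k) * (DG k - w)\<close> converges,
      \<open>DG k - w\<close> itself tends to 0.\<close>
    have "(\<lambda>k. real (Suc k) * (DG k - w) * inverse (real (Suc k)) + w)
        \<longlonglongrightarrow> normalization K G q w * 0 + w"
      by (intro tendsto_intros G LIMSEQ_inverse_real_of_nat)
    moreover have "real (Suc k) * (DG k - w) * inverse (real (Suc k)) + w = DG k" for k
      by (simp add: field_simps del: of_nat_Suc)
    ultimately have "DG \<longlonglongrightarrow> w" by (simp del: of_nat_Suc)
    \<comment> \<open>The product rule in discrete form: \<open>DF k * DG k - u * w\<close> equals
      \<open>DG k * (DF k - u) + u * (DG k - w)\<close>.\<close>
    then have "(\<lambda>k. DG k * (real (Suc k) * (DF k - u)) + u * (real (Suc k) * (DG k - w)))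
        \<longlonglongrightarrow> w * normalization J F p u + u * normalization K G q w"
      by (intro tendsto_intros F G)
    then have FG: "(\<lambda>k. real (Suc k) * (DF k * DG k - u * w))
        \<longlonglongrightarrow> w * normalization J F p u + u * normalization K G q w"
      by (simp add: algebra_simps)
    have "DE k \<le> DF k * DG k" for k
    proof -
      have "x \<in> {..<2} \<rightarrow> J" "y \<in> {..<2} \<rightarrow> K" "l k \<in> weights 2"
        using puqw by (auto simp: x_def y_def l_def weights_def numeral_2_eq_2)
      then show ?thesis using that unfolding v_def DE_def DF_def DG_def by blast
    qed
    then show "normalization I E (p * q) (u * w)
        \<le> w * normalization J F p u + u * normalization K G q w"
      by (intro LIMSEQ_le[OF E FG] exI[of _ 0]) (simp add: mult_left_mono del: of_nat_Suc)
  qed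

  have vi_imp_all: "D_inf_le I E n (\<lambda>i. x i * y i) l \<le> D_inf_le J F n x l * D_inf_le K G n y l
      \<and> D_inf_lt I E n (\<lambda>i. x i * y i) l \<le> D_inf_lt J F n x l * D_inf_lt K G n y l
      \<and> D_sup_gt I E n (\<lambda>i. x i * y i) l \<le> D_sup_gt J F n x l * D_sup_gt K G n y l
      \<and> D_sup_ge I E n (\<lambda>i. x i * y i) l \<le> D_sup_ge J F n x l * D_sup_ge K G n y l"
    if vi and xyl: "x \<in> {..<n} \<rightarrow> J" "y \<in> {..<n} \<rightarrow> K" "l \<in> weights n"
    for n x y l
  proof -
    obtain a b where ab: "a \<in> J" "b \<in> J" "\<forall>i<n. a \<le> x i \<and> x i \<le> b"
      using F.weighted_range[OF xyl(1,3)] by blast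
    obtain c d where cd: "c \<in> K" "d \<in> K" "\<forall>i<n. c \<le> y i \<and> y i \<le> d"
      using G.weighted_range[OF xyl(2,3)] by blast
    have "(\<lambda>i. x i * y i) \<in> {..<n} \<rightarrow> I" using xyl mult by blast
    then obtain e f where ef: "e \<in> I" "f \<in> I" "\<forall>i<n. e \<le> x i * y i \<and> x i * y i \<le> f"
      using E.weighted_range[of "\<lambda>i. x i * y i" n l] xyl by blast
    note F = xyl(3) ab and G = xyl(3) cd and E = xyl(3) ef
    let ?e = "dev_sum E n (\<lambda>i. x i * y i) l"
    let ?f = "dev_sum F n x l" and ?g = "dev_sum G n y l"
    \<comment> \<open>Each normalizing denominator depends only on the second argument, so it is
      common to all terms of its sum.\<close>
    have sum_le: "?e (u * w) / (- diag_deriv I E (u * w))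
        \<le> w * (?f u / (- diag_deriv J F u)) + u * (?g w / (- diag_deriv K G w))"
      if uw: "u \<in> J" "w \<in> K" for u w
    proof -
      have "?e (u * w) / (- diag_deriv I E (u * w))
          = (\<Sum>i<n. l i * normalization I E (x i * y i) (u * w))"
        by (simp add: dev_sum_def normalization_def sum_divide_distrib sum_negf)
      also have "\<dots> \<le> (\<Sum>i<n. l i * (w * normalization J F (x i) u + u * normalization K G (y i) w))"
      proof (intro sum_mono mult_left_mono)
        fix i assume "i \<in> {..<n}"
        then show "0 \<le> l i" using xyl(3) by (simp add: weights_def)
        from \<open>i \<in> {..<n}\<close> have "x i \<in> J" "y i \<in> K" using xyl by auto
        then show "normalization I E (x i * y i) (u * w)
            \<le> w * normalization J F (x i) u + u * normalization K G (y i) w"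
          using \<open>vi\<close> uw unfolding vi_def by blast
      qed
      also have "\<dots> = w * (?f u / (- diag_deriv J F u)) + u * (?g w / (- diag_deriv K G w))"
        by (simp add: dev_sum_def normalization_def sum_divide_distrib sum_negf sum_distrib_left
            sum.distrib algebra_simps sum_subtractf)
      finally show ?thesis .
    qed
    \<comment> \<open>The normalizing denominators and the points \<open>u\<close>, \<open>w\<close>
      are positive, so dividing and multiplying by them preserves signs.\<close>
    have nonpos: "?e (u * w) \<le> 0" if uw: "u \<in> J" "w \<in> K" "?f u \<le> 0" "?g w \<le> 0" for u w
    proof -
      have "w * (?f u / (- diag_deriv J F u)) \<le> 0" "u * (?g w / (- diag_deriv K G w)) \<le> 0"
        using uw pos F.diag_neg[OF uw(1)] G.diag_neg[OF uw(2)]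
        by (auto intro!: mult_nonneg_nonpos divide_nonpos_neg divide_nonneg_neg less_imp_le
            simp: divide_le_0_iff zero_le_divide_iff mult_le_0_iff zero_le_mult_iff)
      then have "?e (u * w) / (- diag_deriv I E (u * w)) \<le> 0"
        using sum_le[OF uw(1,2)] by linarith
      then show ?thesis
        using E.diag_neg[OF mult[OF uw(1,2)]] by (auto simp: divide_le_0_iff zero_le_divide_iff)
    qed
    have neg: "?e (u * w) < 0" if uw: "u \<in> J" "w \<in> K" "?f u < 0" "?g w < 0" for u w
    proof -
      have "?f u / (- diag_deriv J F u) < 0" "?g w / (- diag_deriv K G w) < 0"
        using uw F.diag_neg[OF uw(1)] G.diag_neg[OF uw(2)]
        by (auto intro!: divide_neg_pos divide_neg_neg)
      then have "w * (?f u / (- diag_deriv J F u)) < 0" "u * (?g w / (- diag_deriv K G w)) < 0"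
        using mult_pos_neg[OF pos(2)[OF uw(2)]] mult_pos_neg[OF pos(1)[OF uw(1)]] by blast+
      then have "?e (u * w) / (- diag_deriv I E (u * w)) < 0"
        using sum_le[OF uw(1,2)] by linarith
      then show ?thesis
        using E.diag_neg[OF mult[OF uw(1,2)]] by (auto simp: divide_less_0_iff zero_less_divide_iff)
    qed
    note Fm = F.mean_mem[OF F] and Gm = G.mean_mem[OF G]
    \<comment> \<open>By \<open>nonpos\<close>, products of points from the sets defining the two
      right-hand infima lie in the set defining the left-hand one.\<close>
    have "D_inf_le I E n (\<lambda>i. x i * y i) l \<le> D_inf_le J F n x l * D_inf_le K G n y l"
      using F.inf_le_facts[OF F] G.inf_le_facts[OF G] E.inf_le_facts[OF E] mult nonpos
        Fm[THEN pos(1)] Gm[THEN pos(2)] pos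
      unfolding D_inf_le_def by (intro Inf_mult_le) auto
    moreover have "D_inf_lt I E n (\<lambda>i. x i * y i) l \<le> D_inf_lt J F n x l * D_inf_lt K G n y l"
      using F.inf_lt_facts[OF F] G.inf_lt_facts[OF G] E.inf_lt_facts[OF E] mult neg
        Fm[THEN pos(1)] Gm[THEN pos(2)] pos
      unfolding D_inf_lt_def by (intro Inf_mult_le) auto
    \<comment> \<open>For suprema the signs are used contrapositively: a point of the set exceeding
      the product would factor into points beyond both means, where the \<open>F\<close>- and
      \<open>G\<close>-sums are nonpositive, so the \<open>E\<close>-sum could not be
      positive.\<close>
    moreover have "D_sup_gt I E n (\<lambda>i. x i * y i) l \<le> D_sup_gt J F n x l * D_sup_gt K G n y l"
      unfolding D_sup_gt_def[of I]
    proof (intro cSup_least E.sup_gt_facts[OF E])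
      fix z assume "z \<in> {z \<in> I. 0 < ?e z}"
      then have z: "z \<in> J * K" "0 < ?e z" using assms(7) by auto
      show "z \<le> D_sup_gt J F n x l * D_sup_gt K G n y l"
      proof (rule ccontr)
        assume "\<not> ?thesis"
        then obtain u w where uw: "u \<in> J" "w \<in> K" "D_sup_gt J F n x l < u"
            "D_sup_gt K G n y l < w" "z = u * w"
          using factor_above[OF assms(1,4,3,6,2,5) Fm(3) Gm(3) z(1)] by (auto simp: not_le)
        then have "?f u \<le> 0" "?g w \<le> 0"
          using F.D_sup_gt_upper[OF F, of u] G.D_sup_gt_upper[OF G, of w] uw by linarith+
        then show False using nonpos[OF uw(1,2)] z uw by auto
      qed
    qed
    \<comment> \<open>Beyond these larger means the sums are strictly negative, so
      \<open>neg\<close> takes the place of \<open>nonpos\<close>.\<close>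
    moreover have "D_sup_ge I E n (\<lambda>i. x i * y i) l \<le> D_sup_ge J F n x l * D_sup_ge K G n y l"
      unfolding D_sup_ge_def[of I]
    proof (intro cSup_least E.sup_ge_facts[OF E])
      fix z assume "z \<in> {z \<in> I. 0 \<le> ?e z}"
      then have z: "z \<in> J * K" "0 \<le> ?e z" using assms(7) by auto
      show "z \<le> D_sup_ge J F n x l * D_sup_ge K G n y l"
      proof (rule ccontr)
        assume "\<not> ?thesis"
        then obtain u w where uw: "u \<in> J" "w \<in> K" "D_sup_ge J F n x l < u"
            "D_sup_ge K G n y l < w" "z = u * w"
          using factor_above[OF assms(1,4,3,6,2,5) Fm(4) Gm(4) z(1)] by (auto simp: not_le)
        then have "?f u < 0" "?g w < 0"
          using F.D_sup_ge_upper[OF F, of u] G.D_sup_ge_upper[OF G, of w] uw by linarith+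
        then show False using neg[OF uw(1,2)] z uw by auto
      qed
    qed
    ultimately show ?thesis by blast
  qed
  show ?thesis
    unfolding Let_def vi_def[symmetric] v_def[symmetric]
    using all_imp_v v_imp_vi vi_imp_all unfolding v_def by (smt (verit))
qed

end
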